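(* Fix an integer $N>0$ and $N$-tuples $\mathbf{m}=(m_0,\dots,m_{N-1})$, $\mathbf{n}=(n_0,\dots,n_{N-1})$ of real numbers, each tuple having pairwise distinct coordinates. Then the following are equivalent. (1) For all vectors $\mathbf{u} \in (0,+\infty)^N$, we have $$\frac{|\det (\mathbf{u}^{\circ m_0} | \dots | \mathbf{u}^{\circ m_{N-1}})|}{|V(\mathbf{m})|} \geqslant \frac{|\det (\mathbf{u}^{\circ n_0} | \dots | \mathbf{u}^{\circ n_{N-1}})|}{|V(\mathbf{n})|}.$$ (2) The tuple $\mathbf{m}$ majorizes $\mathbf{n}$.
   Context: For $\mathbf{u}=(u_1,\dots,u_N)^T$ with positive coordinates and real $\alpha$, $\mathbf{u}^{\circ \alpha} := (u_1^\alpha,\dots,u_N^\alpha)^T$; $(\mathbf{u}^{\circ m_0} | \dots | \mathbf{u}^{\circ m_{N-1}})$ is the $N\times N$ matrix with these columns. For a tuple $(t_0,\dots,t_{N-1})$, $V(t_0,\dots,t_{N-1}) := \prod_{0 \leqslant i < j \leqslant N-1} (t_j - t_i)$. For real $N$-tuples, let $x_{[1]} \geqslant \cdots \geqslant x_{[N]}$ denote the decreasing rearrangement of the coordinates of $\mathbf{x}$; then $\mathbf{x}$ majorizes $\mathbf{y}$ if $\sum_{j=1}^k x_{[j]} \geqslant \sum_{j=1}^k y_{[j]}$ for all $0 < k < N$ and $\sum_{j=1}^N x_{[j]} = \sum_{j=1}^N y_{[j]}$. *)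

theory Defs
  imports Complex_Main "Jordan_Normal_Form.Determinant"
begin

text \<open>
  Real \<open>N\<close>-tuples are vectors in \<^term>\<open>carrier_vec N\<close>, with coordinates indexed by
  \<open>0, \<dots>, N - 1\<close>.
\<close>

definition hadamard_powr :: "real Matrix.vec \<Rightarrow> real \<Rightarrow> real Matrix.vec" where
  "hadamard_powr u a = map_vec (\<lambda>x. x powr a) u"

definition gen_vandermonde_mat :: "real Matrix.vec \<Rightarrow> real Matrix.vec \<Rightarrow> real mat" where
  "gen_vandermonde_mat u t =
     mat_of_cols (dim_vec u) (map (hadamard_powr u) (list_of_vec t))"

definition vandermonde :: "real Matrix.vec \<Rightarrow> real" where
  "vandermonde t = (\<Prod>j<dim_vec t. \<Prod>i<j. t $ j - t $ i)"

definition decr_rearr :: "real Matrix.vec \<Rightarrow> real list" where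
  "decr_rearr x = rev (sort (list_of_vec x))"

text \<open>
  Entry \<open>j\<close> of \<^const>\<open>decr_rearr\<close> is \<open>x\<^sub>[\<^sub>j\<^sub>+\<^sub>1\<^sub>]\<close>, since lists are indexed from \<open>0\<close>.
\<close>

definition majorizes :: "real Matrix.vec \<Rightarrow> real Matrix.vec \<Rightarrow> bool" where
  "majorizes x y \<longleftrightarrow> dim_vec x = dim_vec y \<and>
     (\<forall>k. 0 < k \<and> k < dim_vec x \<longrightarrow>
        (\<Sum>j<k. decr_rearr x ! j) \<ge> (\<Sum>j<k. decr_rearr y ! j)) \<and>
     (\<Sum>j<dim_vec x. decr_rearr x ! j) = (\<Sum>j<dim_vec y. decr_rearr y ! j)"

end

theory Submission
  imports Defs
begin

text \<open>
  Put \<open>u\<^sub>i = exp x\<^sub>i\<close>. The quotient in question is then \<open>G(x; m) = det (exp (x\<^sub>i m\<^sub>j)) / V(m)\<close> up to sign.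
  It is symmetric in the \<open>m\<^sub>j\<close>, and permuting the \<open>x\<^sub>i\<close> changes at most its sign, so \<open>x\<close> may be taken
  nondecreasing.

  Why majorization suffices. For nondecreasing \<open>x\<close> the function \<open>m \<mapsto> G(x; m)\<close> is a positive mixture of
  exponentials \<open>m \<mapsto> exp \<langle>y, m\<rangle>\<close>: it is the integral of \<open>exp \<langle>weight, m\<rangle>\<close> over the Gelfand-Tsetlin patterns with
  boundary \<open>x\<close>, the continuous counterpart of writing a Schur polynomial as a sum over tableaux. Therefore
  every linear inequality \<open>0 \<le> (\<Sum>k. a\<^sub>k exp \<langle>y, m\<^sub>k\<rangle>)\<close> that holds for all \<open>y\<close> is inherited by \<open>G(x; \<cdot>)\<close>. The
  mixing measure is never constructed; \<open>expdet_quotient_positive\<close> proves the inheritance directly, by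
  induction on \<open>N\<close>: one layer of the pattern corresponds to replacing the rows of a determinant by their
  differences, and each row difference is the integral of a row of the same exponential type. The
  inequality that is fed in is Muirhead's,
  \<open>(\<Sum>\<sigma>. exp \<langle>y, n \<circ> \<sigma>\<rangle>) \<le> (\<Sum>\<sigma>. exp \<langle>y, m \<circ> \<sigma>\<rangle>)\<close>, which holds for all \<open>y\<close> when \<open>m\<close> majorizes \<open>n\<close>
  (\<open>muirhead_exp\<close>). Since \<open>G(x; \<cdot>)\<close> is symmetric and nonnegative, the inherited inequality says
  \<open>N! G(x; n) \<le> N! G(x; m)\<close>. Symmetrizing both sides keeps every exponent tuple free of repeated
  entries, whereas a chain of elementary transfers from \<open>m\<close> to \<open>n\<close> could run through tuples with
  repetitions, where \<open>V\<close> vanishes.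

  Why it is necessary. Let \<open>m\<close> and \<open>n\<close> be sorted decreasingly, let \<open>y\<close> be strictly decreasing and put
  \<open>x = s y\<close>. As \<open>s\<close> tends to infinity, the identity permutation alone dominates the Leibniz expansion, by the
  strict rearrangement inequality, so \<open>\<bar>G(s y; m)\<bar>\<close> grows like \<open>exp (s \<langle>y, m\<rangle>) / \<bar>V(m)\<bar>\<close>. The assumed
  inequality forces \<open>\<langle>y, n\<rangle> \<le> \<langle>y, m\<rangle>\<close>, and letting \<open>y\<close> tend to indicators of initial segments and to
  the constants \<open>1\<close> and \<open>-1\<close> gives majorization.
\<close>

section \<open>Determinants of exponential type\<close>

definition vander :: "nat \<Rightarrow> (nat \<Rightarrow> real) \<Rightarrow> real" where
  "vander N m = (\<Prod>j<N. \<Prod>i<j. m j - m i)"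

definition expdet :: "nat \<Rightarrow> (nat \<Rightarrow> real) \<Rightarrow> (nat \<Rightarrow> real) \<Rightarrow> real" where
  "expdet N x m = Determinant.det (mat N N (\<lambda>(i,j). exp (x i * m j)))"

lemma vander_Suc:
  "vander (Suc n) m = (\<Prod>j<n. m (Suc j) - m 0) * vander n (\<lambda>j. m (Suc j))"
  unfolding vander_def by (simp only: prod.lessThan_Suc_shift prod.distrib) simp

lemma vander_nonzero: "inj_on m {..<N} \<Longrightarrow> vander N m \<noteq> 0"
  unfolding vander_def by (auto dest: inj_onD)

lemma det_scale_rows:
  "Determinant.det (mat N N (\<lambda>(i,j). c i * A i j))
     = (\<Prod>i<N. c i) * Determinant.det (mat N N (\<lambda>(i,j). A i j :: real))"
proof -
  have "(\<Prod>i = 0..<N. mat N N (\<lambda>(i,j). c i * A i j) $$ (i, p i))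
      = (\<Prod>i<N. c i) * (\<Prod>i = 0..<N. mat N N (\<lambda>(i,j). A i j) $$ (i, p i))"
    if "p permutes {0..<N}" for p
  proof -
    have "p i < N" if "i < N" for i using permutes_in_image[OF \<open>p permutes {0..<N}\<close>, of i] that by simp
    thus ?thesis unfolding prod.distrib[symmetric] atLeast0LessThan
      by (intro prod.cong) auto
  qed
  note entry = this
  have c: "mat N N (\<lambda>(i,j). c i * A i j) \<in> carrier_mat N N" "mat N N (\<lambda>(i,j). A i j) \<in> carrier_mat N N"
    by simp_all
  show ?thesis
    unfolding det_def'[OF c(1)] det_def'[OF c(2)] sum_distrib_left
    by (rule sum.cong[OF refl], subst entry) (auto simp: mult.left_commute)
qed

lemma det_scale_columns:
  "Determinant.det (mat N N (\<lambda>(i,j). A i j * c j))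
     = Determinant.det (mat N N (\<lambda>(i,j). A i j :: real)) * (\<Prod>j<N. c j)"
proof -
  have T: "(mat N N (\<lambda>(i,j). f i j))\<^sup>T = mat N N (\<lambda>(i,j). f j i)" for f :: "nat \<Rightarrow> nat \<Rightarrow> real"
    by auto
  have D: "Determinant.det (mat N N (\<lambda>(i,j). f i j)) = Determinant.det (mat N N (\<lambda>(i,j). f j i))"
    for f :: "nat \<Rightarrow> nat \<Rightarrow> real"
    using det_transpose[of "mat N N (\<lambda>(i,j). f i j)" N] by (simp add: T)
  show ?thesis
    unfolding D[of "\<lambda>i j. A i j * c j"] D[of A]
    using det_scale_rows[of N c "\<lambda>i j. A j i"] by (simp add: mult.commute)
qed

text \<open>
  Subtracting from each row its predecessor is left multiplication by a unit lower bidiagonal matrix; it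
  turns the first column into a unit vector, along which the determinant is expanded.
\<close>

lemma det_row_differences:
  fixes A :: "nat \<Rightarrow> nat \<Rightarrow> real"
  assumes "\<And>i. A i 0 = 1"
  shows "Determinant.det (mat (Suc n) (Suc n) (\<lambda>(i,j). A i j))
       = Determinant.det (mat n n (\<lambda>(i,j). A (Suc i) (Suc j) - A i (Suc j)))"
proof -
  define B where "B = mat (Suc n) (Suc n) (\<lambda>(i,j). A i j)"
  define L where "L = mat (Suc n) (Suc n) (\<lambda>(i,j). if i = j then 1 else if i = Suc j then - 1 else 0 :: real)"
  have B: "B \<in> carrier_mat (Suc n) (Suc n)" and L: "L \<in> carrier_mat (Suc n) (Suc n)"
    by (auto simp: B_def L_def)
  have "Determinant.det L = prod_list (diag_mat L)"
    by (rule det_lower_triangular[OF _ L]) (auto simp: L_def)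
  also have "diag_mat L = map (\<lambda>_. 1) [0..<Suc n]"
    by (auto simp: diag_mat_def L_def)
  finally have detL: "Determinant.det L = 1" by (simp add: prod_list_replicate map_replicate_const)
  have LB: "L * B = mat (Suc n) (Suc n) (\<lambda>(i,j). if i = 0 then A 0 j else A i j - A (i - 1) j)"
  proof (rule eq_matI, goal_cases)
    case (1 i j)
    hence ij: "i < Suc n" "j < Suc n" by auto
    have "(L * B) $$ (i,j) = (\<Sum>k<Suc n. (if i = k then 1 else if i = Suc k then - 1 else 0) * A k j)"
      using ij unfolding L_def B_def
      by (auto simp: scalar_prod_def atLeast0LessThan intro!: sum.cong)
    also have "\<dots> = (\<Sum>k<Suc n. (if k = i then A k j else 0) - (if Suc k = i then A k j else 0))"
      by (intro sum.cong) auto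
    also have "\<dots> = A i j - (\<Sum>k<Suc n. (if Suc k = i then A k j else 0))"
      using ij by (simp only: sum_subtractf sum.delta finite_lessThan) auto
    also have "(\<Sum>k<Suc n. (if Suc k = i then A k j else 0)) = (if i = 0 then 0 else A (i - 1) j)"
      using ij by (cases i) (auto simp: sum.delta simp del: sum.lessThan_Suc)
    finally show ?case using ij by auto
  qed (auto simp: L_def B_def)
  have LBc: "L * B \<in> carrier_mat (Suc n) (Suc n)" using L B by simp
  have "Determinant.det B = Determinant.det (L * B)" by (simp add: det_mult[OF L B] detL)
  also have "\<dots> = (\<Sum>i<Suc n. (L * B) $$ (i,0) * cofactor (L * B) i 0)"
    by (rule laplace_expansion_column[OF LBc]) simp
  also have "\<dots> = (\<Sum>i<Suc n. if i = 0 then cofactor (L * B) i 0 else 0)"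
    by (intro sum.cong refl) (auto simp: LB assms)
  also have "\<dots> = cofactor (L * B) 0 0" by (simp add: sum.delta del: sum.lessThan_Suc)
  also have "\<dots> = Determinant.det (mat_delete (L * B) 0 0)" by (simp add: cofactor_def)
  also have "mat_delete (L * B) 0 0 = mat n n (\<lambda>(i,j). A (Suc i) (Suc j) - A i (Suc j))"
    by (rule eq_matI) (auto simp: mat_delete_def LB)
  finally show ?thesis by (simp add: B_def)
qed

lemma expdet_shift:
  "expdet N x (\<lambda>j. m j + c) = exp (c * (\<Sum>i<N. x i)) * expdet N x m"
proof -
  have "expdet N x (\<lambda>j. m j + c) = Determinant.det (mat N N (\<lambda>(i,j). exp (c * x i) * exp (x i * m j)))"
    unfolding expdet_def by (intro arg_cong[where f = Determinant.det] cong_mat refl)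
      (auto simp: exp_add[symmetric] algebra_simps)
  thus ?thesis
    by (simp add: det_scale_rows expdet_def exp_sum sum_distrib_left)
qed

text \<open>
  One layer of the Gelfand-Tsetlin recursion: after extraction of the factors \<open>exp (m\<^sub>0 x\<^sub>i)\<close> the first
  column is constant, so the order of the determinant drops by one at the price of row differences.
\<close>

lemma expdet_Suc:
  "expdet (Suc n) x m = exp (m 0 * (\<Sum>i<Suc n. x i)) *
     Determinant.det (mat n n (\<lambda>(i,j). exp (x (Suc i) * (m (Suc j) - m 0)) - exp (x i * (m (Suc j) - m 0))))"
  using expdet_shift[of "Suc n" x "\<lambda>j. m j - m 0" "m 0"]
    det_row_differences[of "\<lambda>i j. exp (x i * (m j - m 0))" n]
  by (simp add: expdet_def)

section \<open>Positive mixtures of exponentials\<close>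

text \<open>
  An integrated form of nonnegativity: the determinant is linear in each row, so the sum with rows
  \<open>E(x\<^sub>i\<^sub>+\<^sub>1) - E(x\<^sub>i)\<close> is the iterated integral over the box \<open>t\<^sub>i \<in> [x\<^sub>i, x\<^sub>i\<^sub>+\<^sub>1]\<close> of the sum with rows
  \<open>e(t\<^sub>i)\<close>, where \<open>e\<close> is the derivative of \<open>E\<close>. Integrals are avoided by exchanging one row at a time: with the
  other rows held fixed, the sum is a function of the exchanged row's argument whose derivative is
  nonnegative, so its increment over the interval is nonnegative.
\<close>

lemma sum_det_row_increments_nonneg:
  fixes e E :: "'k \<Rightarrow> nat \<Rightarrow> real \<Rightarrow> real" and x :: "nat \<Rightarrow> real"
  assumes deriv: "\<And>k j s. (E k j has_real_derivative e k j s) (at s)"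
    and mono: "\<And>i. i < n \<Longrightarrow> x i \<le> x (Suc i)"
    and nonneg: "\<And>t. (\<And>i. i < n \<Longrightarrow> x i \<le> t i \<and> t i \<le> x (Suc i)) \<Longrightarrow>
        0 \<le> (\<Sum>k\<in>K. b k * Determinant.det (mat n n (\<lambda>(i,j). e k j (t i))))"
  shows "0 \<le> (\<Sum>k\<in>K. b k * Determinant.det (mat n n (\<lambda>(i,j). E k j (x (Suc i)) - E k j (x i))))"
proof -
  define M where "M p t R k = mat n n (\<lambda>(i,j). if i = p then R k j else if i < p
      then E k j (x (Suc i)) - E k j (x i) else e k j (t i))"
    for p and t :: "nat \<Rightarrow> real" and R k
  have "0 \<le> (\<Sum>k\<in>K. b k * Determinant.det (mat n n (\<lambda>(i,j). if i < p
      then E k j (x (Suc i)) - E k j (x i) else e k j (t i))))"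
    if "p \<le> n" "\<And>i. i < n \<Longrightarrow> x i \<le> t i \<and> t i \<le> x (Suc i)" for p t
    using that
  proof (induction p arbitrary: t)
    case 0
    thus ?case using nonneg[of t] by simp
  next
    case (Suc p)
    hence p: "p < n" by simp
    \<comment> \<open>The cofactors along row \<open>p\<close> do not depend on that row, so it may be filled with zeros here.\<close>
    define C where "C k j = cofactor (M p t (\<lambda>_ _. 0) k) p j" for k j
    have expand: "Determinant.det (M p t R k) = (\<Sum>j<n. R k j * C k j)" for R k
    proof -
      have minor: "mat_delete (M p t R k) p j = mat_delete (M p t (\<lambda>_ _. 0) k) p j" for j
        by (rule eq_matI) (auto simp: mat_delete_def M_def)
      have "Determinant.det (M p t R k) = (\<Sum>j<n. M p t R k $$ (p,j) * cofactor (M p t R k) p j)"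
        by (rule laplace_expansion_row[OF _ p]) (simp add: M_def)
      also have "\<dots> = (\<Sum>j<n. M p t R k $$ (p,j) * C k j)"
        using minor by (simp add: C_def cofactor_def)
      finally show ?thesis using p by (simp add: M_def)
    qed
    define \<phi> where "\<phi> s = (\<Sum>k\<in>K. b k * (\<Sum>j<n. E k j s * C k j))" for s
    have "\<phi> (x p) \<le> \<phi> (x (Suc p))"
    proof (rule DERIV_nonneg_imp_nondecreasing[OF mono[OF p]])
      fix s assume s: "x p \<le> s" "s \<le> x (Suc p)"
      have "(\<phi> has_real_derivative (\<Sum>k\<in>K. b k * (\<Sum>j<n. e k j s * C k j))) (at s)"
        unfolding \<phi>_def by (intro DERIV_sum DERIV_cmult DERIV_cmult_right deriv)
      moreover have "0 \<le> (\<Sum>k\<in>K. b k * (\<Sum>j<n. e k j s * C k j))"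
      proof -
        have "0 \<le> (\<Sum>k\<in>K. b k * Determinant.det (mat n n (\<lambda>(i,j). if i < p
          then E k j (x (Suc i)) - E k j (x i) else e k j ((t(p := s)) i))))"
          using Suc.prems s by (intro Suc.IH) auto
        moreover have "mat n n (\<lambda>(i,j). if i < p
            then E k j (x (Suc i)) - E k j (x i) else e k j ((t(p := s)) i))
          = M p t (\<lambda>k j. e k j s) k" for k
          by (rule eq_matI) (auto simp: M_def)
        ultimately show ?thesis by (simp only: expand)
      qed
      ultimately show "\<exists>y. (\<phi> has_real_derivative y) (at s) \<and> 0 \<le> y" by blast
    qed
    have next_row: "M p t (\<lambda>k j. E k j (x (Suc p)) - E k j (x p)) k = mat n n (\<lambda>(i,j). if i < Suc p
      then E k j (x (Suc i)) - E k j (x i) else e k j (t i))" for k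
      by (rule eq_matI) (auto simp: M_def less_Suc_eq)
    have "0 \<le> \<phi> (x (Suc p)) - \<phi> (x p)" using \<open>\<phi> (x p) \<le> \<phi> (x (Suc p))\<close> by simp
    also have "\<dots> = (\<Sum>k\<in>K. b k * (\<Sum>j<n. (E k j (x (Suc p)) - E k j (x p)) * C k j))"
      by (simp add: \<phi>_def sum_subtractf left_diff_distrib right_diff_distrib)
    also have "\<dots> = (\<Sum>k\<in>K. b k * Determinant.det (M p t (\<lambda>k j. E k j (x (Suc p)) - E k j (x p)) k))"
      by (simp add: expand)
    finally show ?case by (simp only: next_row)
  qed
  from this[of n x] mono
  have "0 \<le> (\<Sum>k\<in>K. b k * Determinant.det (mat n n (\<lambda>(i,j). if i < n
      then E k j (x (Suc i)) - E k j (x i) else e k j (x i))))" by simp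
  moreover have "mat n n (\<lambda>(i,j). if i < n then E k j (x (Suc i)) - E k j (x i) else e k j (x i))
      = mat n n (\<lambda>(i,j). E k j (x (Suc i)) - E k j (x i))" for k
    by (rule eq_matI) auto
  ultimately show ?thesis by (simp only:)
qed

text \<open>
  The quotient is a positive mixture of the functions \<open>m \<mapsto> exp \<langle>y, m\<rangle>\<close>. In the induction the coordinate
  \<open>m\<^sub>0\<close> is split off: with \<open>s = (\<Sum>i. x\<^sub>i) - (\<Sum>i. t\<^sub>i)\<close> the integrand for the interlacing point \<open>t\<close> is the quotient of
  order \<open>N - 1\<close> with coefficients \<open>a\<^sub>k exp (m\<^sub>k\<^sub>0 s)\<close>, and the hypothesis on these coefficients is the given one
  at the vector \<open>y\<close> extended by the entry \<open>s\<close>. The signed coefficients \<open>a\<close> are what lets the factor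
  depending on \<open>m\<^sub>0\<close> be absorbed.
\<close>

lemma expdet_quotient_positive:
  fixes a :: "'k \<Rightarrow> real" and m :: "'k \<Rightarrow> nat \<Rightarrow> real" and x :: "nat \<Rightarrow> real"
  assumes "\<And>k. k \<in> K \<Longrightarrow> inj_on (m k) {..<N}"
    and "\<And>i. Suc i < N \<Longrightarrow> x i \<le> x (Suc i)"
    and "\<And>y. 0 \<le> (\<Sum>k\<in>K. a k * exp (\<Sum>i<N. y i * m k i))"
  shows "0 \<le> (\<Sum>k\<in>K. a k * (expdet N x (m k) / vander N (m k)))"
  using assms
proof (induction N arbitrary: a m x)
  case 0
  thus ?case by (simp add: expdet_def vander_def)
next
  case (Suc n)
  define m' where "m' k j = m k (Suc j)" for k j
  define d where "d k j = m' k j - m k 0" for k j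
  have inj': "inj_on (m' k) {..<n}" if "k \<in> K" for k
    using Suc.prems(1)[OF that] by (auto simp: inj_on_def m'_def)
  have d: "d k j \<noteq> 0" if "k \<in> K" "j < n" for k j
    using inj_onD[OF Suc.prems(1)[OF that(1)], of "Suc j" 0] that by (auto simp: d_def m'_def)
  define X where "X = (\<Sum>i<Suc n. x i)"
  define b where "b k = a k * exp (m k 0 * X) / vander n (m' k)" for k
  \<comment> \<open>The branch \<open>d k j = 0\<close> occurs only outside the index range of interest; it makes \<open>E k j\<close> an antiderivative of \<open>e k j\<close> for all indices.\<close>
  define E where "E k j s = (if d k j = 0 then s else exp (s * d k j) / d k j)" for k j s
  define e where "e k j s = exp (s * d k j)" for k j s
  have "0 \<le> (\<Sum>k\<in>K. b k * Determinant.det (mat n n (\<lambda>(i,j). E k j (x (Suc i)) - E k j (x i))))"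
  proof (rule sum_det_row_increments_nonneg[where e = e])
    show "(E k j has_real_derivative e k j s) (at s)" for k j s
      unfolding E_def e_def by (cases "d k j = 0") (auto intro!: derivative_eq_intros)
    show "x i \<le> x (Suc i)" if "i < n" for i using Suc.prems(2) that by simp
    fix t assume t: "\<And>i. i < n \<Longrightarrow> x i \<le> t i \<and> t i \<le> x (Suc i)"
    define s where "s = X - (\<Sum>i<n. t i)"
    have "0 \<le> (\<Sum>k\<in>K. (a k * exp (m k 0 * s)) * (expdet n t (m' k) / vander n (m' k)))"
    proof (rule Suc.IH[OF inj'])
      show "t i \<le> t (Suc i)" if "Suc i < n" for i
        using t[of i] t[of "Suc i"] that by simp
      show "0 \<le> (\<Sum>k\<in>K. a k * exp (m k 0 * s) * exp (\<Sum>i<n. y i * m' k i))" for y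
        using Suc.prems(3)[of "case_nat s y"]
        by (simp only: sum.lessThan_Suc_shift nat.case exp_add m'_def) (simp add: mult.commute[of s] mult.assoc)
    qed
    also have "\<dots> = (\<Sum>k\<in>K. b k * Determinant.det (mat n n (\<lambda>(i,j). e k j (t i))))"
    proof (rule sum.cong[OF refl])
      fix k
      have "Determinant.det (mat n n (\<lambda>(i,j). e k j (t i))) = expdet n t (d k)"
        by (simp add: expdet_def e_def)
      also have "\<dots> = exp (- m k 0 * (\<Sum>i<n. t i)) * expdet n t (m' k)"
        using expdet_shift[of n t "m' k" "- m k 0"] by (simp add: d_def[abs_def])
      finally show "(a k * exp (m k 0 * s)) * (expdet n t (m' k) / vander n (m' k))
          = b k * Determinant.det (mat n n (\<lambda>(i,j). e k j (t i)))"
        by (simp add: b_def s_def right_diff_distrib exp_diff exp_minus divide_inverse mult_ac)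
    qed
    finally show "0 \<le> \<dots>" .
  qed
  also have "\<dots> = (\<Sum>k\<in>K. a k * (expdet (Suc n) x (m k) / vander (Suc n) (m k)))"
  proof (rule sum.cong[OF refl])
    fix k assume k: "k \<in> K"
    define D where "D = (\<Prod>j<n. d k j)"
    define A where "A i j = exp (x (Suc i) * d k j) - exp (x i * d k j)" for i j
    have D0: "D \<noteq> 0" using d[OF k] by (simp add: D_def)
    have "Determinant.det (mat n n (\<lambda>(i,j). E k j (x (Suc i)) - E k j (x i)))
        = Determinant.det (mat n n (\<lambda>(i,j). A i j * inverse (d k j)))"
      using d[OF k] by (intro arg_cong[where f = Determinant.det] cong_mat)
        (auto simp: E_def A_def field_simps)
    also have "\<dots> = Determinant.det (mat n n (\<lambda>(i,j). A i j)) / D"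
      by (simp add: det_scale_columns D_def prod_inversef[unfolded o_def, symmetric] divide_inverse)
    finally have 1: "Determinant.det (mat n n (\<lambda>(i,j). E k j (x (Suc i)) - E k j (x i)))
        = Determinant.det (mat n n (\<lambda>(i,j). A i j)) / D" .
    have 2: "vander (Suc n) (m k) = D * vander n (m' k)"
      by (simp add: vander_Suc D_def d_def m'_def[abs_def])
    have 3: "expdet (Suc n) x (m k) = exp (m k 0 * X) * Determinant.det (mat n n (\<lambda>(i,j). A i j))"
      unfolding expdet_Suc X_def A_def d_def m'_def ..
    show "b k * Determinant.det (mat n n (\<lambda>(i,j). E k j (x (Suc i)) - E k j (x i)))
        = a k * (expdet (Suc n) x (m k) / vander (Suc n) (m k))"
      unfolding 1 2 3 b_def using D0 by (simp add: mult_ac)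
  qed
  finally show ?case .
qed

section \<open>Asymptotics and the rearrangement inequality\<close>

lemma sum_le_sum_initial_segment:
  fixes m :: "nat \<Rightarrow> real"
  assumes "antimono_on {..<N} m" "A \<subseteq> {..<N}"
  shows "sum m A \<le> sum m {..<card A}"
  using assms
proof (induction N arbitrary: A)
  case (Suc N)
  have anti: "antimono_on {..<N} m"
    using Suc.prems(1) by (rule monotone_on_subset) auto
  show ?case
  proof (cases "N \<in> A")
    case True
    define A' where "A' = A - {N}"
    have A': "A' \<subseteq> {..<N}" "A = insert N A'" "N \<notin> A'" using Suc.prems(2) True by (auto simp: A'_def less_Suc_eq)
    have fin: "finite A'" using A'(1) finite_subset by blast
    have "card A' \<le> N" using card_mono[OF _ A'(1)] by simp
    hence "m N \<le> m (card A')" by (intro monotone_onD[OF Suc.prems(1)]) auto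
    thus ?thesis using Suc.IH[OF anti A'(1)] fin A' by simp
  next
    case False
    thus ?thesis using Suc.prems(2) by (intro Suc.IH[OF anti]) (auto simp: less_Suc_eq)
  qed
qed simp

lemma summation_by_parts:
  fixes y d :: "nat \<Rightarrow> real"
  shows "(\<Sum>i<Suc n. y i * d i) =
    y n * (\<Sum>i<Suc n. d i) + (\<Sum>k<n. (y k - y (Suc k)) * (\<Sum>i<Suc k. d i))"
  by (induction n) (simp_all add: algebra_simps)

text \<open>
  Summation by parts writes the deficit as a combination of the partial sums of \<open>m i - m (\<sigma> i)\<close> with
  positive weights. These partial sums are nonnegative, since initial segments carry the largest values, and
  the one ending at the first index moved by \<open>\<sigma>\<close> is positive.
\<close>

lemma strict_rearrangement:
  fixes y m :: "nat \<Rightarrow> real"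
  assumes y: "\<And>i j. i < j \<Longrightarrow> j < N \<Longrightarrow> y j < y i"
    and m: "\<And>i j. i < j \<Longrightarrow> j < N \<Longrightarrow> m j < m i"
    and \<sigma>: "\<sigma> permutes {..<N}" "\<sigma> \<noteq> id"
  shows "(\<Sum>i<N. y i * m (\<sigma> i)) < (\<Sum>i<N. y i * m i)"
proof -
  define d where "d i = m i - m (\<sigma> i)" for i
  define i0 where "i0 = (LEAST i. \<sigma> i \<noteq> i)"
  have "\<exists>i. \<sigma> i \<noteq> i" using \<sigma>(2) by (auto simp: fun_eq_iff)
  hence i0: "\<sigma> i0 \<noteq> i0" and fix_below: "\<And>i. i < i0 \<Longrightarrow> \<sigma> i = i"
    unfolding i0_def using LeastI_ex[of "\<lambda>i. \<sigma> i \<noteq> i"] not_less_Least by blast+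
  have inj: "inj \<sigma>" by (rule permutes_inj[OF \<sigma>(1)])
  have "\<not> \<sigma> i0 < i0"
    using fix_below[of "\<sigma> i0"] injD[OF inj, of "\<sigma> i0" i0] i0 by auto
  hence gt: "i0 < \<sigma> i0" using i0 by simp
  have "i0 < N" using i0 \<sigma>(1) by (auto simp: permutes_def)
  hence \<sigma>N: "\<sigma> i0 < N" using permutes_in_image[OF \<sigma>(1), of i0] by simp
  obtain n where n: "N = Suc n" using \<open>i0 < N\<close> by (cases N) auto
  have anti: "antimono_on {..<N} m"
    using m by (intro monotone_onI) (auto simp: order_le_less)
  have D: "0 \<le> (\<Sum>i<k. d i)" if "k \<le> N" for k
  proof -
    have "(\<Sum>i<k. m (\<sigma> i)) = sum m (\<sigma> ` {..<k})"
      by (rule sum.reindex_cong[OF permutes_inj_on[OF \<sigma>(1)] refl refl, symmetric])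
    also have "\<dots> \<le> sum m {..<card (\<sigma> ` {..<k})}"
      using image_mono[of "{..<k}" "{..<N}" \<sigma>] that
      by (intro sum_le_sum_initial_segment[OF anti]) (simp add: permutes_image[OF \<sigma>(1)])
    also have "card (\<sigma> ` {..<k}) = k" by (simp add: card_image permutes_inj_on[OF \<sigma>(1)])
    finally show ?thesis by (simp add: d_def sum_subtractf)
  qed
  have "(\<Sum>i<N. m (\<sigma> i)) = (\<Sum>i<N. m i)"
    using sum.permute[OF \<sigma>(1), of m] by (simp add: o_def)
  hence DN: "(\<Sum>i<Suc n. d i) = 0" by (simp add: d_def sum_subtractf n)
  have "i0 < n" using gt \<sigma>N n by simp
  have "(\<Sum>i<Suc i0. d i) = d i0" by (simp add: d_def fix_below)
  hence D0: "0 < (\<Sum>i<Suc i0. d i)" using m[OF gt \<sigma>N] by (simp add: d_def)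
  have "0 < (\<Sum>k<n. (y k - y (Suc k)) * (\<Sum>i<Suc k. d i))"
  proof (rule sum_pos2[where i = i0])
    show "0 < (y i0 - y (Suc i0)) * (\<Sum>i<Suc i0. d i)"
      using D0 y[of i0 "Suc i0"] \<open>i0 < n\<close> n by (intro mult_pos_pos) auto
    show "0 \<le> (y k - y (Suc k)) * (\<Sum>i<Suc k. d i)" if "k \<in> {..<n}" for k
      using D[of "Suc k"] y[of k "Suc k"] that n by (intro mult_nonneg_nonneg) auto
  qed (use \<open>i0 < n\<close> in auto)
  hence "0 < (\<Sum>i<N. y i * d i)"
    unfolding n summation_by_parts DN by simp
  thus ?thesis by (simp add: d_def right_diff_distrib sum_subtractf)
qed

text \<open>
  In the Leibniz expansion the term of \<open>\<sigma>\<close> has the growth rate \<open>\<langle>y, m \<circ> \<sigma>\<rangle>\<close>, which is largest for the identity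
  only.
\<close>

lemma expdet_leading_term:
  fixes y m :: "nat \<Rightarrow> real"
  assumes y: "\<And>i j. i < j \<Longrightarrow> j < N \<Longrightarrow> y j < y i"
    and m: "\<And>i j. i < j \<Longrightarrow> j < N \<Longrightarrow> m j < m i"
  shows "((\<lambda>s. expdet N (\<lambda>i. s * y i) m * exp (- s * (\<Sum>i<N. y i * m i))) \<longlongrightarrow> 1) at_top"
proof -
  define P where "P = {\<sigma>. \<sigma> permutes {..<N}}"
  define c where "c \<sigma> = (\<Sum>i<N. y i * m (\<sigma> i)) - (\<Sum>i<N. y i * m i)" for \<sigma>
  have fin: "finite P" and idP: "id \<in> P" by (auto simp: P_def finite_permutations permutes_id)
  have "expdet N (\<lambda>i. s * y i) m * exp (- s * (\<Sum>i<N. y i * m i)) = (\<Sum>\<sigma>\<in>P. sign \<sigma> * exp (c \<sigma> * s))" for s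
  proof -
    have car: "mat N N (\<lambda>(i,j). exp (s * y i * m j)) \<in> carrier_mat N N" by simp
    have "expdet N (\<lambda>i. s * y i) m = (\<Sum>\<sigma>\<in>P. sign \<sigma> * exp (s * (\<Sum>i<N. y i * m (\<sigma> i))))"
      unfolding expdet_def det_def'[OF car] atLeast0LessThan P_def
    proof (intro sum.cong refl arg_cong2[where f = "(*)"])
      fix \<sigma> assume "\<sigma> \<in> {p. p permutes {..<N}}"
      hence "\<sigma> i < N" if "i < N" for i using permutes_in_image[of \<sigma> "{..<N}" i] that by simp
      thus "(\<Prod>i<N. mat N N (\<lambda>(i,j). exp (s * y i * m j)) $$ (i, \<sigma> i)) = exp (s * (\<Sum>i<N. y i * m (\<sigma> i)))"
        by (simp add: exp_sum sum_distrib_left mult.assoc)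
    qed
    moreover have "exp (c \<sigma> * s) = exp (s * (\<Sum>i<N. y i * m (\<sigma> i))) * exp (- s * (\<Sum>i<N. y i * m i))" for \<sigma>
      by (simp add: c_def exp_add[symmetric] algebra_simps)
    ultimately show ?thesis by (simp only: sum_distrib_right mult.assoc)
  qed
  moreover have "((\<lambda>s. \<Sum>\<sigma>\<in>P. sign \<sigma> * exp (c \<sigma> * s)) \<longlongrightarrow> (\<Sum>\<sigma>\<in>P. if \<sigma> = id then 1 else 0 :: real)) at_top"
  proof (rule tendsto_sum)
    fix \<sigma> assume "\<sigma> \<in> P"
    show "((\<lambda>s. sign \<sigma> * exp (c \<sigma> * s)) \<longlongrightarrow> (if \<sigma> = id then 1 else 0 :: real)) at_top"
    proof (cases "\<sigma> = id")
      case True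
      thus ?thesis by (simp add: c_def)
    next
      case False
      hence "c \<sigma> < 0" using strict_rearrangement[OF y m _ False] \<open>\<sigma> \<in> P\<close> by (simp add: c_def P_def)
      hence "filterlim (\<lambda>s. c \<sigma> * s) at_bot at_top"
        by (intro filterlim_tendsto_neg_mult_at_bot[OF tendsto_const _ filterlim_ident])
      from tendsto_mult[OF tendsto_const filterlim_compose[OF exp_at_bot this], of "sign \<sigma>"]
      show ?thesis using False by simp
    qed
  qed
  ultimately show ?thesis using fin idP by (simp add: sum.delta)
qed

section \<open>Majorization and Muirhead's inequality\<close>

lemma sorted_straddle:
  fixes m :: "real list"
  assumes "sorted_wrt (\<ge>) m" "2 \<le> length m" "c \<le> hd m" "last m \<le> c"
  shows "\<exists>p a b q. m = p @ a # b # q \<and> b \<le> c \<and> c \<le> a"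
  using assms
proof (induction m rule: induct_list012)
  case (3 a b q)
  show ?case
  proof (cases "b \<le> c")
    case True
    thus ?thesis using 3 by (intro exI[of _ "[]"]) auto
  next
    case False
    hence "q \<noteq> []" using 3 by auto
    hence "\<exists>p a' b' q'. b # q = p @ a' # b' # q' \<and> b' \<le> c \<and> c \<le> a'"
      using 3 False by (intro 3) (auto simp: Suc_le_eq)
    then obtain p a' b' q' where "b # q = p @ a' # b' # q'" "b' \<le> c" "c \<le> a'" by blast
    thus ?thesis by (intro exI[of _ "a # p"] exI[of _ a'] exI[of _ b'] exI[of _ q']) auto
  qed
qed auto

text \<open>
  The Hardy-Littlewood-Polya reduction of majorization to transfers between two entries. Let \<open>c\<close> be the head of
  the majorized list. Two neighbours \<open>a \<ge> c \<ge> b\<close> of \<open>m\<close> can be replaced by \<open>c\<close> and \<open>a + b - c\<close>; what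
  remains after removal of \<open>c\<close> is still sorted and still majorizes the tail. Up to position \<open>p\<close> this holds
  because all entries of \<open>p\<close> are at least \<open>c\<close> and all entries of the tail at most \<open>c\<close>; beyond it, the partial sums
  are those of \<open>m\<close>, less \<open>c\<close>. The function \<open>f\<close> is kept general so that the induction can pass to \<open>\<lambda>l. f (c # l)\<close>.
\<close>

lemma symmetric_function_majorization:
  fixes f :: "real list \<Rightarrow> real"
  assumes "sorted_wrt (\<ge>) m" "sorted_wrt (\<ge>) n" "length m = length n"
    and "\<And>k. k \<le> length n \<Longrightarrow> sum_list (take k n) \<le> sum_list (take k m)"
    and "sum_list m = sum_list n"
    and "\<And>l l'. mset l = mset l' \<Longrightarrow> f l = f l'"
    and "\<And>a b a' b' r. b \<le> a' \<Longrightarrow> a' \<le> a \<Longrightarrow> a' + b' = a + b \<Longrightarrow> f (a' # b' # r) \<le> f (a # b # r)"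
  shows "f n \<le> f m"
  using assms
proof (induction n arbitrary: m f)
  case Nil
  show ?case using Nil.prems(3) by simp
next
  case (Cons c n)
  note sym = Cons.prems(6) and transfer = Cons.prems(7)
  show ?case
  proof (cases "n = []")
    case True
    then obtain a where "m = [a]" using Cons.prems(3) by (auto simp: length_Suc_conv)
    thus ?thesis using Cons.prems(5) True by simp
  next
    case False
    have len: "2 \<le> length m" using False Cons.prems(3) by (cases n) auto
    have n_le: "x \<le> c" if "x \<in> set n" for x using Cons.prems(2) that by auto
    have "m \<noteq> []" using len by auto
    have "c \<le> hd m" using Cons.prems(4)[of 1] \<open>m \<noteq> []\<close> by (cases m) auto
    moreover have "last m \<le> c"
    proof -
      have split_last: "sum_list l = sum_list (butlast l) + last l" if "l \<noteq> []" for l :: "real list"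
        using arg_cong[OF append_butlast_last_id[OF that], of sum_list] by simp
      have "sum_list (butlast (c # n)) \<le> sum_list (butlast m)"
        using Cons.prems(4)[of "length n"] Cons.prems(3) by (simp add: butlast_conv_take)
      moreover have "sum_list m = sum_list (butlast m) + last m"
        by (rule split_last[OF \<open>m \<noteq> []\<close>])
      moreover have "sum_list (c # n) = sum_list (butlast (c # n)) + last (c # n)"
        by (rule split_last) simp
      ultimately have "last m \<le> last n" using Cons.prems(5) False by simp
      also have "last n \<le> c" using False by (intro n_le) simp
      finally show ?thesis .
    qed
    ultimately obtain p a b q where m: "m = p @ a # b # q" and ab: "b \<le> c" "c \<le> a"
      using sorted_straddle[OF Cons.prems(1) len] by blast
    define m' where "m' = p @ (a + b - c) # q"
    have p_ge: "c \<le> x" if "x \<in> set p" for x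
    proof -
      have "a \<le> x" using that Cons.prems(1) unfolding m by (simp add: sorted_wrt_append)
      thus ?thesis using ab by simp
    qed
    have "f (c # n) \<le> f (c # m')"
    proof (rule Cons.IH[where f = "\<lambda>l. f (c # l)"])
      show "sorted_wrt (\<ge>) m'"
      proof -
        have "sorted_wrt (\<ge>) p" "sorted_wrt (\<ge>) q" "\<forall>x\<in>set p. a \<le> x" "\<forall>x\<in>set q. x \<le> b"
          "\<forall>x\<in>set p. \<forall>z\<in>set q. z \<le> x"
          using Cons.prems(1) unfolding m by (simp_all add: sorted_wrt_append)
        moreover have "x \<le> a + b - c" if "x \<le> b" for x using that ab by linarith
        moreover have "a + b - c \<le> x" if "a \<le> x" for x using that ab by linarith
        ultimately show ?thesis unfolding m'_def by (simp add: sorted_wrt_append)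
      qed
      show "sorted_wrt (\<ge>) n" using Cons.prems(2) by simp
      show len': "length m' = length n" using Cons.prems(3) by (simp add: m m'_def)
      show "sum_list (take k n) \<le> sum_list (take k m')" if k: "k \<le> length n" for k
      proof (cases "k \<le> length p")
        case True
        have "sum_list (take k n) \<le> sum_list (map (\<lambda>_. c) (take k n))"
          using sum_list_mono[of "take k n" "\<lambda>x. x" "\<lambda>_. c"] n_le by (auto dest: in_set_takeD)
        also have "\<dots> = sum_list (map (\<lambda>_. c) (take k p))" using True k by (simp add: sum_list_triv)
        also have "\<dots> \<le> sum_list (take k p)"
          using sum_list_mono[of "take k p" "\<lambda>_. c" "\<lambda>x. x"] p_ge by (auto dest: in_set_takeD)
        finally show ?thesis using True by (simp add: m'_def)
      next
        case False
        then obtain i where i: "k = Suc (length p + i)" by (metis less_imp_Suc_add not_le)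
        have "c + sum_list (take k n) \<le> sum_list (take (Suc k) m)"
          using Cons.prems(4)[of "Suc k"] k by simp
        also have "\<dots> = c + sum_list (take k m')" by (simp add: m m'_def i)
        finally show ?thesis by simp
      qed
      show "sum_list m' = sum_list n" using Cons.prems(5) by (simp add: m m'_def)
      show "f (c # l) = f (c # l')" if "mset l = mset l'" for l l' using that by (intro sym) simp
      show "f (c # a' # b' # r) \<le> f (c # a # b # r)"
        if "b \<le> a'" "a' \<le> a" "a' + b' = a + b" for a b a' b' r
        using transfer[OF that, of "c # r"] sym[of "c # a' # b' # r" "a' # b' # c # r"]
          sym[of "c # a # b # r" "a # b # c # r"] by simp
    qed
    also have "f (c # m') = f (c # (a + b - c) # p @ q)" by (intro sym) (simp add: m'_def)
    also have "\<dots> \<le> f (a # b # p @ q)" using ab by (intro transfer) auto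
    also have "\<dots> = f m" by (intro sym) (simp add: m)
    finally show ?thesis .
  qed
qed

lemma exp_convex_combination:
  fixes A B t :: real
  assumes "0 \<le> t" "t \<le> 1"
  shows "exp (t * A + (1 - t) * B) \<le> t * exp A + (1 - t) * exp B"
proof -
  define c where "c = t * A + (1 - t) * B"
  have tangent: "exp c * (1 + (x - c)) \<le> exp x" for x
  proof -
    have "exp c * (1 + (x - c)) \<le> exp c * exp (x - c)" by (intro mult_left_mono exp_ge_add_one_self) auto
    also have "\<dots> = exp x" by (simp add: exp_add[symmetric])
    finally show ?thesis .
  qed
  have "exp c = t * (exp c * (1 + (A - c))) + (1 - t) * (exp c * (1 + (B - c)))"
    unfolding c_def by (simp add: algebra_simps)
  also have "\<dots> \<le> t * exp A + (1 - t) * exp B"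
    using assms by (intro add_mono mult_left_mono tangent) auto
  finally show ?thesis by (simp add: c_def)
qed

definition perm_exp_sum :: "(nat \<Rightarrow> real) \<Rightarrow> real list \<Rightarrow> real" where
  "perm_exp_sum y l = (\<Sum>\<sigma> | \<sigma> permutes {..<length l}. exp (\<Sum>i<length l. y i * l ! \<sigma> i))"

lemma perm_exp_sum_permute_list:
  assumes "p permutes {..<length l}"
  shows "perm_exp_sum y (permute_list p l) = perm_exp_sum y l"
proof -
  define F where "F \<sigma> = exp (\<Sum>i<length l. y i * l ! \<sigma> i)" for \<sigma>
  have "perm_exp_sum y (permute_list p l) = (\<Sum>\<sigma> | \<sigma> permutes {..<length l}. F (p \<circ> \<sigma>))"
    unfolding perm_exp_sum_def F_def length_permute_list
  proof (intro sum.cong refl arg_cong[where f = exp])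
    fix \<sigma> i assume "\<sigma> \<in> {\<sigma>. \<sigma> permutes {..<length l}}" "i \<in> {..<length l}"
    hence "\<sigma> i < length l" using permutes_in_image[of \<sigma> "{..<length l}" i] by simp
    thus "y i * permute_list p l ! \<sigma> i = y i * l ! (p \<circ> \<sigma>) i"
      by (simp add: permute_list_nth[OF assms])
  qed
  also have "\<dots> = perm_exp_sum y l"
    using setum_permutations_compose_left[OF assms, of F] by (simp add: perm_exp_sum_def F_def)
  finally show ?thesis .
qed

text \<open>
  A transfer produces a convex combination of the original list and the one with its first two entries
  swapped; both have the same permutation sum, and the exponential is convex.
\<close>

lemma perm_exp_sum_transfer:
  assumes "b \<le> a'" "a' \<le> a" "a' + b' = a + b"
  shows "perm_exp_sum y (a' # b' # r) \<le> perm_exp_sum y (a # b # r)"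
proof -
  define t where "t = (if a = b then 1 else (a' - b) / (a - b))"
  have t: "0 \<le> t" "t \<le> 1" using assms by (auto simp: t_def divide_simps)
  have a': "a' = t * a + (1 - t) * b"
    using assms by (auto simp: t_def field_simps)
  have b': "b' = t * b + (1 - t) * a" using assms(3) unfolding a' by (simp add: algebra_simps)
  define L where "L = length (a # b # r)"
  have conv: "(a' # b' # r) ! k = t * (a # b # r) ! k + (1 - t) * (b # a # r) ! k" for k
    unfolding a' b' by (auto simp: nth_Cons algebra_simps split: nat.splits)
  have "perm_exp_sum y (a' # b' # r) =
      (\<Sum>\<sigma> | \<sigma> permutes {..<L}. exp (t * (\<Sum>i<L. y i * (a # b # r) ! \<sigma> i) + (1 - t) * (\<Sum>i<L. y i * (b # a # r) ! \<sigma> i)))"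
    unfolding perm_exp_sum_def conv by (simp add: L_def sum_distrib_left sum.distrib[symmetric] algebra_simps del: sum.lessThan_Suc)
  also have "\<dots> \<le> (\<Sum>\<sigma> | \<sigma> permutes {..<L}. t * exp (\<Sum>i<L. y i * (a # b # r) ! \<sigma> i) + (1 - t) * exp (\<Sum>i<L. y i * (b # a # r) ! \<sigma> i))"
    by (intro sum_mono exp_convex_combination t)
  also have "\<dots> = t * perm_exp_sum y (a # b # r) + (1 - t) * perm_exp_sum y (b # a # r)"
    by (simp add: perm_exp_sum_def L_def sum.distrib sum_distrib_left del: sum.lessThan_Suc)
  also have "perm_exp_sum y (b # a # r) = perm_exp_sum y (a # b # r)"
  proof -
    have "mset (b # a # r) = mset (a # b # r)" by simp
    then obtain p where "p permutes {..<length (a # b # r)}" "permute_list p (a # b # r) = b # a # r"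
      by (rule mset_eq_permutation)
    thus ?thesis using perm_exp_sum_permute_list by metis
  qed
  finally show ?thesis by (simp add: algebra_simps)
qed

lemma muirhead_exp:
  assumes "sorted_wrt (\<ge>) m" "sorted_wrt (\<ge>) n" "length m = length n"
    and "\<And>k. k \<le> length n \<Longrightarrow> sum_list (take k n) \<le> sum_list (take k m)"
    and "sum_list m = sum_list n"
  shows "perm_exp_sum y n \<le> perm_exp_sum y m"
proof (rule symmetric_function_majorization[OF assms])
  show "perm_exp_sum y l = perm_exp_sum y l'" if "mset l = mset l'" for l l'
  proof -
    from that obtain p where "p permutes {..<length l'}" "permute_list p l' = l"
      by (rule mset_eq_permutation)
    thus ?thesis using perm_exp_sum_permute_list by metis
  qed
qed (use perm_exp_sum_transfer in auto)

section \<open>Symmetry of the normalized determinant\<close>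

lemma expdet_commute: "expdet N x m = expdet N m x"
proof -
  have "(mat N N (\<lambda>(i,j). exp (x i * m j)))\<^sup>T = mat N N (\<lambda>(i,j). exp (m i * x j))"
    by (rule eq_matI) (auto simp: mult.commute)
  thus ?thesis
    using det_transpose[of "mat N N (\<lambda>(i,j). exp (x i * m j))" N] by (simp add: expdet_def)
qed

lemma abs_expdet_permute_left:
  assumes p: "p permutes {..<N}"
  shows "\<bar>expdet N (\<lambda>i. x (p i)) m\<bar> = \<bar>expdet N x m\<bar>"
proof -
  define M where "M = mat N N (\<lambda>(i,j). exp (x i * m j))"
  have M: "M \<in> carrier_mat N N" by (simp add: M_def)
  have p': "p permutes {0..<N}" using p by (simp add: atLeast0LessThan)
  have "mat N N (\<lambda>(i,j). exp (x (p i) * m j)) = mat N N (\<lambda>(i,j). M $$ (p i, j))"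
    using permutes_in_image[OF p] by (intro cong_mat) (auto simp: M_def)
  hence "expdet N (\<lambda>i. x (p i)) m = signof p * expdet N x m"
    using det_permute_rows[OF M p'] by (simp add: expdet_def M_def)
  thus ?thesis by (simp add: abs_mult sign_def)
qed

lemma abs_expdet_permute_right:
  assumes "p permutes {..<N}"
  shows "\<bar>expdet N x (\<lambda>j. m (p j))\<bar> = \<bar>expdet N x m\<bar>"
  using abs_expdet_permute_left[OF assms, of m x] by (simp only: expdet_commute[of N x])

text \<open>
  Squaring makes the product run over all ordered pairs of distinct indices, which shows the invariance under
  permutations without any bookkeeping of signs.
\<close>

lemma vander_squared:
  "(vander N m)\<^sup>2 = (\<Prod>j<N. \<Prod>i<N. if i = j then 1 else \<bar>m j - m i\<bar>)"
proof (induction N)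
  case 0
  thus ?case by (simp add: vander_def)
next
  case (Suc N)
  have "(\<Prod>j<Suc N. \<Prod>i<Suc N. if i = j then 1 else \<bar>m j - m i\<bar>)
      = (\<Prod>j<N. (\<Prod>i<N. if i = j then 1 else \<bar>m j - m i\<bar>) * \<bar>m N - m j\<bar>) * (\<Prod>i<N. \<bar>m N - m i\<bar>)"
    by (simp add: abs_minus_commute)
  also have "\<dots> = (vander N m)\<^sup>2 * (\<Prod>i<N. \<bar>m N - m i\<bar>)\<^sup>2"
    by (simp only: prod.distrib Suc.IH[symmetric]) (simp only: power2_eq_square mult.assoc)
  also have "(\<Prod>i<N. \<bar>m N - m i\<bar>)\<^sup>2 = (\<Prod>i<N. m N - m i)\<^sup>2"
    by (simp add: abs_prod[symmetric])
  finally show ?case by (simp add: vander_def power_mult_distrib)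
qed

lemma abs_vander_permute:
  assumes p: "p permutes {..<N}"
  shows "\<bar>vander N (\<lambda>j. m (p j))\<bar> = \<bar>vander N m\<bar>"
proof -
  define g where "g j i = (if i = j then 1 else \<bar>m j - m i\<bar>)" for i j
  have "(vander N (\<lambda>j. m (p j)))\<^sup>2 = (\<Prod>j<N. \<Prod>i<N. g (p j) (p i))"
    unfolding vander_squared g_def by (simp add: inj_eq[OF permutes_inj[OF p]])
  also have "\<dots> = (\<Prod>j<N. \<Prod>i<N. g (p j) i)"
    using prod.permute[OF p, of "g (p j)" for j] by (simp add: o_def)
  also have "\<dots> = (\<Prod>j<N. \<Prod>i<N. g j i)"
    using prod.permute[OF p, of "\<lambda>j. \<Prod>i<N. g j i"] by (simp add: o_def)
  also have "\<dots> = (vander N m)\<^sup>2"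
    unfolding vander_squared g_def ..
  finally show ?thesis by (simp add: power2_eq_iff abs_eq_iff)
qed

definition norm_expdet :: "nat \<Rightarrow> (nat \<Rightarrow> real) \<Rightarrow> (nat \<Rightarrow> real) \<Rightarrow> real" where
  "norm_expdet N x m = \<bar>expdet N x m\<bar> / \<bar>vander N m\<bar>"

lemma norm_expdet_permute_left:
  "p permutes {..<N} \<Longrightarrow> norm_expdet N (\<lambda>i. x (p i)) m = norm_expdet N x m"
  by (simp add: norm_expdet_def abs_expdet_permute_left)

lemma norm_expdet_permute_right:
  "p permutes {..<N} \<Longrightarrow> norm_expdet N x (\<lambda>j. m (p j)) = norm_expdet N x m"
  by (simp add: norm_expdet_def abs_expdet_permute_right abs_vander_permute)

text \<open>
  The quotient itself is nonnegative, because a single exponential is; so \<open>expdet N x\<close> and \<open>vander N\<close> never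
  have opposite signs when \<open>x\<close> is nondecreasing.
\<close>

lemma norm_expdet_eq_quotient:
  assumes "inj_on m {..<N}" "\<And>i. Suc i < N \<Longrightarrow> x i \<le> x (Suc i)"
  shows "norm_expdet N x m = expdet N x m / vander N m"
proof -
  have "0 \<le> expdet N x m / vander N m"
    using expdet_quotient_positive[of "{()}" "\<lambda>_. m" N x "\<lambda>_. 1"] assms by simp
  thus ?thesis by (simp only: norm_expdet_def abs_divide[symmetric] abs_of_nonneg)
qed

lemma sorting_permutation:
  fixes x :: "nat \<Rightarrow> real"
  shows "\<exists>p. p permutes {..<N} \<and> (\<forall>i. Suc i < N \<longrightarrow> x (p i) \<le> x (p (Suc i)))"
proof -
  define xs where "xs = map x [0..<N]"
  have "mset (sort xs) = mset xs" by simp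
  then obtain p where p: "p permutes {..<length xs}" and sort: "permute_list p xs = sort xs"
    by (rule mset_eq_permutation)
  have nth: "sort xs ! i = x (p i)" if "i < N" for i
    unfolding sort[symmetric]
    using that permute_list_nth[OF p, of i] permutes_in_image[OF p, of i] by (simp add: xs_def)
  have "x (p i) \<le> x (p (Suc i))" if "Suc i < N" for i
    using sorted_nth_mono[OF sorted_sort[of xs], of i "Suc i"] that nth[of i] nth[of "Suc i"]
    by (simp add: xs_def)
  moreover have "p permutes {..<N}" using p by (simp add: xs_def)
  ultimately show ?thesis by blast
qed

section \<open>Comparison of normalized determinants\<close>

text \<open>
  Positivity is applied to the family of all permutations of \<open>m\<close>, with coefficient \<open>1\<close>, and of \<open>n\<close>, with
  coefficient \<open>-1\<close>; by symmetry all members of one kind contribute the same value.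
\<close>

lemma norm_expdet_mono:
  assumes m: "inj_on m {..<N}" and n: "inj_on n {..<N}"
    and le: "\<And>y. (\<Sum>\<sigma> | \<sigma> permutes {..<N}. exp (\<Sum>i<N. y i * n (\<sigma> i)))
        \<le> (\<Sum>\<sigma> | \<sigma> permutes {..<N}. exp (\<Sum>i<N. y i * m (\<sigma> i)))"
  shows "norm_expdet N x n \<le> norm_expdet N x m"
proof -
  obtain p where p: "p permutes {..<N}" and mono: "\<And>i. Suc i < N \<Longrightarrow> x (p i) \<le> x (p (Suc i))"
    using sorting_permutation[of N x] by blast
  define z where "z i = x (p i)" for i
  define P where "P = {\<sigma>. \<sigma> permutes {..<N}}"
  have fin: "finite P" and "id \<in> P" by (simp_all add: P_def finite_permutations permutes_id)
  define a :: "bool \<times> (nat \<Rightarrow> nat) \<Rightarrow> real" where "a = (\<lambda>(b,\<sigma>). if b then 1 else -1)"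
  define f :: "bool \<times> (nat \<Rightarrow> nat) \<Rightarrow> nat \<Rightarrow> real"
    where "f = (\<lambda>(b,\<sigma>) i. (if b then m else n) (\<sigma> i))"
  have split: "(\<Sum>k\<in>UNIV \<times> P. a k * h (f k)) = (\<Sum>\<sigma>\<in>P. h (\<lambda>i. m (\<sigma> i))) - (\<Sum>\<sigma>\<in>P. h (\<lambda>i. n (\<sigma> i)))"
    for h :: "(nat \<Rightarrow> real) \<Rightarrow> real"
  proof -
    have "(\<Sum>k\<in>UNIV \<times> P. a k * h (f k)) = (\<Sum>b\<in>UNIV. \<Sum>\<sigma>\<in>P. a (b,\<sigma>) * h (f (b,\<sigma>)))"
      unfolding sum.cartesian_product by (rule sum.cong) auto
    also have "\<dots> = (\<Sum>\<sigma>\<in>P. h (\<lambda>i. m (\<sigma> i))) - (\<Sum>\<sigma>\<in>P. h (\<lambda>i. n (\<sigma> i)))"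
      by (simp add: UNIV_bool a_def f_def sum_negf)
    finally show ?thesis .
  qed
  have inj: "inj_on (\<lambda>i. h (\<sigma> i)) {..<N}" if "inj_on h {..<N}" "\<sigma> \<in> P" for h :: "nat \<Rightarrow> real" and \<sigma>
    using that(2) comp_inj_on[OF permutes_inj_on, of \<sigma> "{..<N}" h "{..<N}"] that(1)
    by (simp add: P_def permutes_image o_def)
  have z: "z i \<le> z (Suc i)" if "Suc i < N" for i using mono[OF that] by (simp add: z_def)
  have quot: "expdet N z (\<lambda>i. h (\<sigma> i)) / vander N (\<lambda>i. h (\<sigma> i)) = norm_expdet N x h"
    if "inj_on h {..<N}" "\<sigma> \<in> P" for h :: "nat \<Rightarrow> real" and \<sigma>
  proof -
    have "norm_expdet N z (\<lambda>i. h (\<sigma> i)) = expdet N z (\<lambda>i. h (\<sigma> i)) / vander N (\<lambda>i. h (\<sigma> i))"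
      by (intro norm_expdet_eq_quotient inj[OF that] z)
    moreover have "norm_expdet N z (\<lambda>i. h (\<sigma> i)) = norm_expdet N x h"
      using that(2) by (simp add: norm_expdet_permute_right norm_expdet_permute_left[OF p] P_def z_def[abs_def])
    ultimately show ?thesis by simp
  qed
  have "0 \<le> (\<Sum>k\<in>UNIV \<times> P. a k * (expdet N z (f k) / vander N (f k)))"
  proof (rule expdet_quotient_positive)
    show "z i \<le> z (Suc i)" if "Suc i < N" for i by (rule z[OF that])
    show "inj_on (f k) {..<N}" if "k \<in> UNIV \<times> P" for k
      using that inj[OF m] inj[OF n] by (cases k) (auto simp: f_def)
    show "0 \<le> (\<Sum>k\<in>UNIV \<times> P. a k * exp (\<Sum>i<N. y i * f k i))" for y
      unfolding split[of "\<lambda>g. exp (\<Sum>i<N. y i * g i)"] using le[of y] by (simp add: P_def)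
  qed
  also have "\<dots> = (\<Sum>\<sigma>\<in>P. norm_expdet N x m) - (\<Sum>\<sigma>\<in>P. norm_expdet N x n)"
    unfolding split[of "\<lambda>g. expdet N z g / vander N g"] by (simp add: quot m n)
  finally have "card P * norm_expdet N x n \<le> card P * norm_expdet N x m" by simp
  moreover have "0 < card P" using fin \<open>id \<in> P\<close> by (auto simp: card_gt_0_iff)
  ultimately show ?thesis by simp
qed

lemma strictly_decreasing_inj_on:
  fixes m :: "nat \<Rightarrow> real"
  assumes "\<And>i j. i < j \<Longrightarrow> j < N \<Longrightarrow> m j < m i"
  shows "inj_on m {..<N}"
proof (rule inj_onI)
  fix i j assume "i \<in> {..<N}" "j \<in> {..<N}" "m i = m j"
  thus "i = j" using assms[of i j] assms[of j i] by (cases i j rule: linorder_cases) auto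
qed

text \<open>
  If \<open>\<langle>y, n\<rangle>\<close> were larger than \<open>\<langle>y, m\<rangle>\<close>, the quotient for \<open>n\<close> would outgrow the one for \<open>m\<close> along \<open>x = s y\<close>.
\<close>

lemma weighted_sum_le_of_norm_expdet_le:
  fixes y m n :: "nat \<Rightarrow> real"
  assumes y: "\<And>i j. i < j \<Longrightarrow> j < N \<Longrightarrow> y j < y i"
    and m: "\<And>i j. i < j \<Longrightarrow> j < N \<Longrightarrow> m j < m i"
    and n: "\<And>i j. i < j \<Longrightarrow> j < N \<Longrightarrow> n j < n i"
    and le: "\<And>x. norm_expdet N x n \<le> norm_expdet N x m"
  shows "(\<Sum>i<N. y i * n i) \<le> (\<Sum>i<N. y i * m i)"
proof (rule ccontr)
  define a b where "a = (\<Sum>i<N. y i * m i)" and "b = (\<Sum>i<N. y i * n i)"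
  assume "\<not> ?thesis"
  hence neg: "a - b < 0" by (simp add: a_def b_def)
  have lead: "((\<lambda>s. norm_expdet N (\<lambda>i. s * y i) h * exp (- s * (\<Sum>i<N. y i * h i))) \<longlongrightarrow> 1 / \<bar>vander N h\<bar>) at_top"
    if h: "\<And>i j. i < j \<Longrightarrow> j < N \<Longrightarrow> h j < h i" for h
  proof -
    have "((\<lambda>s. \<bar>expdet N (\<lambda>i. s * y i) h * exp (- s * (\<Sum>i<N. y i * h i))\<bar> / \<bar>vander N h\<bar>) \<longlongrightarrow> \<bar>1\<bar> / \<bar>vander N h\<bar>) at_top"
      by (intro tendsto_divide tendsto_rabs expdet_leading_term[OF y h] tendsto_const)
         (use vander_nonzero[OF strictly_decreasing_inj_on[OF h]] in auto)
    thus ?thesis by (simp add: norm_expdet_def abs_mult)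
  qed
  have gap: "filterlim (\<lambda>s. (a - b) * s) at_bot at_top"
    by (intro filterlim_tendsto_neg_mult_at_bot[OF tendsto_const neg filterlim_ident])
  have lead_m: "((\<lambda>s. norm_expdet N (\<lambda>i. s * y i) m * exp (- s * a)) \<longlongrightarrow> 1 / \<bar>vander N m\<bar>) at_top"
    unfolding a_def by (rule lead) (rule m)
  have lead_n: "((\<lambda>s. norm_expdet N (\<lambda>i. s * y i) n * exp (- s * b)) \<longlongrightarrow> 1 / \<bar>vander N n\<bar>) at_top"
    unfolding b_def by (rule lead) (rule n)
  from tendsto_mult[OF lead_m filterlim_compose[OF exp_at_bot gap]]
  have "((\<lambda>s. norm_expdet N (\<lambda>i. s * y i) m * exp (- s * a) * exp ((a - b) * s)) \<longlongrightarrow> 0) at_top"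
    by simp
  moreover have "\<forall>\<^sub>F s in at_top. norm_expdet N (\<lambda>i. s * y i) n * exp (- s * b)
      \<le> norm_expdet N (\<lambda>i. s * y i) m * exp (- s * a) * exp ((a - b) * s)"
  proof (rule always_eventually, rule allI)
    fix s
    have "exp (- s * a) * exp ((a - b) * s) = exp (- s * b)"
      by (simp add: exp_add[symmetric] algebra_simps)
    thus "norm_expdet N (\<lambda>i. s * y i) n * exp (- s * b)
      \<le> norm_expdet N (\<lambda>i. s * y i) m * exp (- s * a) * exp ((a - b) * s)"
      using le[of "\<lambda>i. s * y i"] by (simp add: mult.assoc)
  qed
  ultimately have "1 / \<bar>vander N n\<bar> \<le> 0"
    using lead_n by (intro tendsto_le[OF trivial_limit_at_top_linorder])
  thus False using vander_nonzero[OF strictly_decreasing_inj_on[OF n]] by simp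
qed

text \<open>
  The weights of interest, indicators of initial segments and constants, are decreasing but not strictly so;
  they are limits of the strictly decreasing weights \<open>w i - \<epsilon> i\<close>.
\<close>

lemma partial_sums_le_of_weighted_sums_le:
  fixes m n :: "nat \<Rightarrow> real"
  assumes le: "\<And>y. (\<And>i j. i < j \<Longrightarrow> j < N \<Longrightarrow> y j < y i) \<Longrightarrow> (\<Sum>i<N. y i * n i) \<le> (\<Sum>i<N. y i * m i)"
  shows "k \<le> N \<Longrightarrow> (\<Sum>i<k. n i) \<le> (\<Sum>i<k. m i)" and "(\<Sum>i<N. n i) = (\<Sum>i<N. m i)"
proof -
  have perturb: "(\<Sum>i<N. w i * n i) \<le> (\<Sum>i<N. w i * m i)" if w: "\<And>i j. i < j \<Longrightarrow> w j \<le> w i" for w :: "nat \<Rightarrow> real"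
  proof (rule tendsto_le[OF trivial_limit_at_right_real])
    have lim: "((\<lambda>\<epsilon>. \<Sum>i<N. (w i - \<epsilon> * i) * h i) \<longlongrightarrow> (\<Sum>i<N. (w i - 0 * real i) * h i)) (at_right (0::real))"
      for h :: "nat \<Rightarrow> real" by (intro tendsto_intros)
    show "((\<lambda>\<epsilon>. \<Sum>i<N. (w i - \<epsilon> * i) * m i) \<longlongrightarrow> (\<Sum>i<N. w i * m i)) (at_right (0::real))"
      using lim[of m] by simp
    show "((\<lambda>\<epsilon>. \<Sum>i<N. (w i - \<epsilon> * i) * n i) \<longlongrightarrow> (\<Sum>i<N. w i * n i)) (at_right (0::real))"
      using lim[of n] by simp
    show "\<forall>\<^sub>F \<epsilon> in at_right (0::real). (\<Sum>i<N. (w i - \<epsilon> * i) * n i) \<le> (\<Sum>i<N. (w i - \<epsilon> * i) * m i)"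
      using eventually_at_right_less
    proof eventually_elim
      case (elim \<epsilon>)
      have "w j - \<epsilon> * j < w i - \<epsilon> * i" if "i < j" for i j
        using w[OF that] mult_strict_left_mono[OF _ elim, of "real i" "real j"] that by simp
      thus ?case by (intro le) auto
    qed
  qed
  have restrict: "(\<Sum>i<N. (if i < k then 1 else 0) * h i) = (\<Sum>i<k. h i)" if "k \<le> N" for k and h :: "nat \<Rightarrow> real"
    using that by (intro sum.mono_neutral_cong_right) auto
  show "(\<Sum>i<k. n i) \<le> (\<Sum>i<k. m i)" if "k \<le> N" for k
    using perturb[of "\<lambda>i. if i < k then 1 else 0"] by (simp only: restrict[OF that]) auto
  \<comment> \<open>The constant weight \<open>-1\<close> gives the reverse inequality between the total sums.\<close>
  from this[of N] perturb[of "\<lambda>_. - 1"] show "(\<Sum>i<N. n i) = (\<Sum>i<N. m i)"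
    by (simp add: sum_negf)
qed

section \<open>Vectors and their decreasing rearrangements\<close>

lemma det_gen_vandermonde_mat:
  assumes "u \<in> carrier_vec N" "t \<in> carrier_vec N" "\<And>i. i < N \<Longrightarrow> 0 < u $ i"
  shows "Determinant.det (gen_vandermonde_mat u t) = expdet N (\<lambda>i. ln (u $ i)) (\<lambda>j. t $ j)"
  unfolding gen_vandermonde_mat_def expdet_def
proof (intro arg_cong[where f = Determinant.det] eq_matI, goal_cases)
  case (1 i j)
  hence "u $ i \<noteq> 0" "0 < u $ i" using assms(3)[of i] by auto
  thus ?case using 1 assms(1,2)
    by (simp add: mat_of_cols_def hadamard_powr_def powr_def mult.commute list_of_vec_index)
qed (use assms in auto)

lemma decr_rearr_permutation:
  assumes "t \<in> carrier_vec N"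
  obtains p where "p permutes {..<N}" "\<And>i. i < N \<Longrightarrow> decr_rearr t ! i = t $ p i"
proof -
  have "mset (decr_rearr t) = mset (list_of_vec t)" by (simp add: decr_rearr_def)
  then obtain p where p: "p permutes {..<length (list_of_vec t)}" "permute_list p (list_of_vec t) = decr_rearr t"
    by (rule mset_eq_permutation)
  have len: "length (list_of_vec t) = N" using assms by simp
  show ?thesis
  proof (rule that)
    show "p permutes {..<N}" using p(1) by (simp only: len)
    show "decr_rearr t ! i = t $ p i" if "i < N" for i
      using that permute_list_nth[OF p(1), of i] permutes_in_image[OF p(1), of i] len assms
      by (simp add: p(2) list_of_vec_index)
  qed
qed

lemma norm_expdet_decr_rearr:
  assumes "t \<in> carrier_vec N"
  shows "norm_expdet N x (\<lambda>j. decr_rearr t ! j) = norm_expdet N x (\<lambda>j. t $ j)"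
proof -
  obtain p where p: "p permutes {..<N}" "\<And>i. i < N \<Longrightarrow> decr_rearr t ! i = t $ p i"
    using decr_rearr_permutation[OF assms] by blast
  have "norm_expdet N x (\<lambda>j. decr_rearr t ! j) = norm_expdet N x (\<lambda>j. t $ p j)"
    unfolding norm_expdet_def expdet_def vander_def
    by (intro arg_cong2[where f = "(/)"] arg_cong[where f = abs] arg_cong[where f = Determinant.det] cong_mat prod.cong)
       (auto simp: p(2))
  thus ?thesis using norm_expdet_permute_right[OF p(1), of x "\<lambda>j. t $ j"] by simp
qed

lemma decr_rearr_sorted: "sorted_wrt (\<ge>) (decr_rearr t)"
  by (simp add: decr_rearr_def sorted_wrt_rev)

lemma decr_rearr_strictly_decreasing:
  assumes "t \<in> carrier_vec N" "distinct (list_of_vec t)" "i < j" "j < N"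
  shows "decr_rearr t ! j < decr_rearr t ! i"
proof -
  have len: "length (decr_rearr t) = N" using assms(1) by (simp add: decr_rearr_def)
  have "distinct (decr_rearr t)" using assms(2) by (simp add: decr_rearr_def)
  hence "decr_rearr t ! j \<noteq> decr_rearr t ! i" using assms len by (simp add: nth_eq_iff_index_eq)
  moreover have "decr_rearr t ! j \<le> decr_rearr t ! i"
    using sorted_wrt_nth_less[OF decr_rearr_sorted, of i j t] assms len by simp
  ultimately show ?thesis by simp
qed

section \<open>The majorization criterion\<close>

theorem theorem1p15:
  fixes N :: nat and m n :: "real Matrix.vec"
  assumes "N > 0"
    and "m \<in> carrier_vec N" and "n \<in> carrier_vec N"
    and "distinct (list_of_vec m)" and "distinct (list_of_vec n)"
  shows "(\<forall>u \<in> carrier_vec N. (\<forall>i<N. u $ i > 0) \<longrightarrow>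
            \<bar>Determinant.det (gen_vandermonde_mat u m)\<bar> / \<bar>vandermonde m\<bar>
              \<ge> \<bar>Determinant.det (gen_vandermonde_mat u n)\<bar> / \<bar>vandermonde n\<bar>)
         \<longleftrightarrow> majorizes m n"
proof -
  define a b where "a = decr_rearr m" and "b = decr_rearr n"
  have len: "length a = N" "length b = N" using assms(2,3) by (simp_all add: a_def b_def decr_rearr_def)
  have dim: "dim_vec m = N" "dim_vec n = N" using assms(2,3) by auto
  have dec_a: "a ! j < a ! i" and dec_b: "b ! j < b ! i" if "i < j" "j < N" for i j
    using decr_rearr_strictly_decreasing assms that unfolding a_def b_def by blast+
  have quotient: "\<bar>Determinant.det (gen_vandermonde_mat u t)\<bar> / \<bar>vandermonde t\<bar>
      = norm_expdet N (\<lambda>i. ln (u $ i)) (\<lambda>j. decr_rearr t ! j)"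
    if "u \<in> carrier_vec N" "\<forall>i<N. u $ i > 0" "t \<in> carrier_vec N" for u t
  proof -
    have "vandermonde t = vander N (\<lambda>j. t $ j)" using that(3) by (simp add: vandermonde_def vander_def)
    thus ?thesis
      unfolding norm_expdet_decr_rearr[OF that(3)]
      using that by (simp add: det_gen_vandermonde_mat norm_expdet_def)
  qed
  have inequality_iff: "(\<forall>u \<in> carrier_vec N. (\<forall>i<N. u $ i > 0) \<longrightarrow>
            \<bar>Determinant.det (gen_vandermonde_mat u m)\<bar> / \<bar>vandermonde m\<bar>
              \<ge> \<bar>Determinant.det (gen_vandermonde_mat u n)\<bar> / \<bar>vandermonde n\<bar>)
      \<longleftrightarrow> (\<forall>x. norm_expdet N x ((!) b) \<le> norm_expdet N x ((!) a))" (is "?L \<longleftrightarrow> ?R")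
  proof
    assume ?R
    thus ?L by (simp add: quotient assms(2,3) a_def b_def)
  next
    assume L: ?L
    show ?R
    proof
      fix x :: "nat \<Rightarrow> real"
      define u where "u = Matrix.vec N (\<lambda>i. exp (x i))"
      have u: "u \<in> carrier_vec N" "\<forall>i<N. u $ i > 0" by (auto simp: u_def)
      have "norm_expdet N (\<lambda>i. ln (u $ i)) h = norm_expdet N x h" for h
        unfolding norm_expdet_def expdet_def
        by (intro arg_cong2[where f = "(/)"] arg_cong[where f = abs] arg_cong[where f = Determinant.det] cong_mat)
           (auto simp: u_def)
      thus "norm_expdet N x ((!) b) \<le> norm_expdet N x ((!) a)"
        using L[rule_format, OF u(1)] u(2) quotient[OF u assms(2)] quotient[OF u assms(3)]
        by (simp add: a_def b_def)
    qed
  qed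
  have prefix: "sum_list (take k l) = (\<Sum>i<k. l ! i)" if "k \<le> length l" for k and l :: "real list"
    using that by (simp add: sum_list_sum_nth atLeast0LessThan min_def)
  have majorizes_iff: "majorizes m n \<longleftrightarrow>
      (\<forall>k\<le>N. (\<Sum>i<k. b ! i) \<le> (\<Sum>i<k. a ! i)) \<and> (\<Sum>i<N. b ! i) = (\<Sum>i<N. a ! i)"
    unfolding majorizes_def dim a_def[symmetric] b_def[symmetric]
  proof (safe, goal_cases)
    case (1 k)
    thus ?case by (cases "k = 0"; cases "k = N") auto
  qed auto
  show ?thesis unfolding inequality_iff majorizes_iff
  proof
    assume "\<forall>x. norm_expdet N x ((!) b) \<le> norm_expdet N x ((!) a)"
    hence "(\<Sum>i<N. y i * b ! i) \<le> (\<Sum>i<N. y i * a ! i)"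
      if "\<And>i j. i < j \<Longrightarrow> j < N \<Longrightarrow> y j < y i" for y :: "nat \<Rightarrow> real"
      using weighted_sum_le_of_norm_expdet_le[of N y "(!) a" "(!) b"] that dec_a dec_b by blast
    from partial_sums_le_of_weighted_sums_le[of N "(!) b" "(!) a", OF this]
    show "(\<forall>k\<le>N. (\<Sum>i<k. b ! i) \<le> (\<Sum>i<k. a ! i)) \<and> (\<Sum>i<N. b ! i) = (\<Sum>i<N. a ! i)"
      by blast
  next
    assume maj: "(\<forall>k\<le>N. (\<Sum>i<k. b ! i) \<le> (\<Sum>i<k. a ! i)) \<and> (\<Sum>i<N. b ! i) = (\<Sum>i<N. a ! i)"
    have "perm_exp_sum y b \<le> perm_exp_sum y a" for y
    proof (rule muirhead_exp)
      show "sorted_wrt (\<ge>) a" "sorted_wrt (\<ge>) b" by (simp_all add: a_def b_def decr_rearr_sorted)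
      show "sum_list (take k b) \<le> sum_list (take k a)" if "k \<le> length b" for k
        using maj that by (simp add: prefix len)
      show "sum_list a = sum_list b"
        using maj prefix[of N a] prefix[of N b] by (simp add: len)
    qed (simp add: len)
    thus "\<forall>x. norm_expdet N x ((!) b) \<le> norm_expdet N x ((!) a)"
      using norm_expdet_mono[OF strictly_decreasing_inj_on[OF dec_a] strictly_decreasing_inj_on[OF dec_b]]
      by (simp add: perm_exp_sum_def len)
  qed
qed

end
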